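(* Let $\mathsf{C}$, $f$, $\mathsf{D}$, the mirror map $\Phi$, the step-size $\eta>0$ and the mirror prox sequence $(\theta_n)_{n\in\mathbb{N}}$ be as in the context, and let $\gamma,\beta>0$ and $\theta_\star\in\mathsf{C}$. Assume: (i) $\mathsf{C}\subset\mathsf{D}$; (ii) $\Phi$ and $f$ are twice differentiable on $\mathsf{C}$ and $C^2$-differentiable in a neighborhood of $\theta_\star$; (iii) $\Phi$ is $\gamma$-strongly convex on $\mathsf{C}$ and $f$ is convex and $\beta$-smooth, with respect to $\|\cdot\|_2$; (iv) $\eta\in(0,\gamma/\beta)$; (v) $\theta_\star$ is the unique minimizer of $f$ on $\mathsf{C}$; (vi) $\theta_\star\in\mathrm{ri}(\mathsf{C})$ and $v^\top\partial^2 f(\theta_\star)v>0$ for all nonzero $v\in\mathrm{span}\{x-y:x,y\in\mathsf{C}\}$. Then, for any initialization $\theta_0\in\mathsf{C}$, the sequence $(\theta_n)_{n\in\mathbb{N}}$ converges to $\theta_\star$, and the convergence is asymptotically geometric: there exists $\rho\in(0,1)$ such that $\theta_n-\theta_\star=o(\rho^n)$ as $n\to\infty$.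
   Context: $\mathsf{C}\subset\mathbb{R}^q$ is a convex compact set, $f$ is a real-valued function on $\mathsf{C}$ (differentiability of $f$ is understood in $\mathbb{R}^q$, $f$ being defined near the points considered), and $\mathsf{D}\subset\mathbb{R}^q$ is a convex open set with $\mathsf{C}\subset\overline{\mathsf{D}}$ and $\mathsf{C}\cap\mathsf{D}\ne\emptyset$. A mirror map is a function $\Phi\colon\mathsf{D}\to\mathbb{R}$ that is strictly convex and differentiable, whose gradient satisfies $\partial\Phi(\mathsf{D})=\mathbb{R}^q$ and $\lim_{x\to\partial\mathsf{D}}\|\partial\Phi(x)\|=+\infty$ (here $\partial\mathsf{D}$ is the boundary of $\mathsf D$). $\partial$ and $\partial^2$ denote gradient and Hessian. The Bregman divergence is $D_\Phi(x,y)=\Phi(x)-\Phi(y)-\partial\Phi(y)^\top(x-y)$ for $x,y\in\mathsf{D}$. Given $\theta_0\in\mathsf{C}\cap\mathsf{D}$, the mirror prox algorithm with step-size $\eta$ is $$\zeta_{n+1}\in\operatorname{argmin}_{\theta\in\mathsf{C}\cap\mathsf{D}}\ \eta\,\partial f(\theta_n)^\top\theta+D_\Phi(\theta,\theta_n),\qquad \theta_{n+1}\in\operatorname{argmin}_{\theta\in\mathsf{C}\cap\mathsf{D}}\ \eta\,\partial f(\zeta_{n+1})^\top\theta+D_\Phi(\theta,\theta_n)$$ (these minimizers exist and are unique). $\Phi$ is $\gamma$-strongly convex on a convex set if $\Phi(x)\ge\Phi(y)+\partial\Phi(y)^\top(x-y)+\frac{\gamma}{2}\|x-y\|_2^2$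 for all $x,y$ in that set; $f$ is $\beta$-smooth if $\|\partial f(x)-\partial f(y)\|_2\le\beta\|x-y\|_2$ for all $x,y\in\mathsf{C}$. $\mathrm{ri}$ denotes relative interior (interior within the affine hull). *)

theory Defs
  imports "HOL-Analysis.Analysis"
begin

(* Meaningful only at points where f is differentiable. *)
definition grad :: "('a::euclidean_space \<Rightarrow> real) \<Rightarrow> 'a \<Rightarrow> 'a" where
  "grad f x = (THE g. GDERIV f x :> g)"

lemma GDERIV_grad:
  fixes f :: "'a::euclidean_space \<Rightarrow> real"
  assumes "f differentiable (at x)"
  shows "GDERIV f x :> grad f x"
proof -
  obtain f' where f': "(f has_derivative f') (at x)"
    using assms unfolding differentiable_def by blast
  then have "linear f'"
    by (rule has_derivative_linear)
  then have "f' h = h \<bullet> adjoint f' 1" for h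
    using adjoint_works[of f' h 1] by simp
  then have "f' = (\<lambda>h. h \<bullet> adjoint f' 1)"
    by (rule ext)
  then have ex: "GDERIV f x :> adjoint f' 1"
    unfolding gderiv_def using f' by (rule has_derivative_subst[rotated])
  show ?thesis
    unfolding grad_def
  proof (rule theI)
    show "GDERIV f x :> adjoint f' 1"
      by (rule ex)
  next
    fix g
    assume "GDERIV f x :> g"
    then have "(\<lambda>h. h \<bullet> g) = (\<lambda>h. h \<bullet> adjoint f' 1)"
      using ex unfolding gderiv_def by (rule has_derivative_unique)
    then have "\<forall>h. h \<bullet> g = h \<bullet> adjoint f' 1"
      by (simp add: fun_eq_iff)
    then show "g = adjoint f' 1"
      by (simp only: vector_eq_ldot)
  qed
qed

definition hessian :: "(real^'q \<Rightarrow> real) \<Rightarrow> real^'q \<Rightarrow> real^'q^'q" where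
  "hessian f x = jacobian (grad f) (at x)"

(* The gradient is required to exist in a full neighbourhood of x, so that its derivative
   at x is an unrestricted one. *)
definition twice_differentiable_at :: "(real^'q \<Rightarrow> real) \<Rightarrow> real^'q \<Rightarrow> bool" where
  "twice_differentiable_at f x \<longleftrightarrow>
     (\<forall>\<^sub>F y in nhds x. f differentiable (at y)) \<and> grad f differentiable (at x)"

definition C2_on_nbhd :: "(real^'q \<Rightarrow> real) \<Rightarrow> real^'q \<Rightarrow> bool" where
  "C2_on_nbhd f x \<longleftrightarrow>
     (\<exists>U. open U \<and> x \<in> U \<and> (\<forall>y\<in>U. twice_differentiable_at f y) \<and>
          continuous_on U (hessian f))"

definition strictly_convex_on :: "'a::real_vector set \<Rightarrow> ('a \<Rightarrow> real) \<Rightarrow> bool" where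
  "strictly_convex_on S f \<longleftrightarrow>
     convex S \<and>
     (\<forall>x\<in>S. \<forall>y\<in>S. \<forall>t. x \<noteq> y \<and> 0 < t \<and> t < 1 \<longrightarrow>
        f ((1 - t) *\<^sub>R x + t *\<^sub>R y) < (1 - t) * f x + t * f y)"

definition strongly_convex_on :: "'a::euclidean_space set \<Rightarrow> real \<Rightarrow> ('a \<Rightarrow> real) \<Rightarrow> bool" where
  "strongly_convex_on S \<gamma> f \<longleftrightarrow>
     (\<forall>x\<in>S. \<forall>y\<in>S. f x \<ge> f y + grad f y \<bullet> (x - y) + \<gamma> / 2 * (norm (x - y))\<^sup>2)"

definition smooth_grad_on :: "'a::euclidean_space set \<Rightarrow> real \<Rightarrow> ('a \<Rightarrow> real) \<Rightarrow> bool" where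
  "smooth_grad_on S \<beta> f \<longleftrightarrow>
     (\<forall>x\<in>S. \<forall>y\<in>S. norm (grad f x - grad f y) \<le> \<beta> * norm (x - y))"

(* The blow-up of the gradient at the boundary is taken pointwise, at each boundary point;
   it is vacuous when D is the whole space. *)
definition mirror_map :: "'a::euclidean_space set \<Rightarrow> ('a \<Rightarrow> real) \<Rightarrow> bool" where
  "mirror_map D \<Phi> \<longleftrightarrow>
     strictly_convex_on D \<Phi> \<and>
     (\<forall>x\<in>D. \<Phi> differentiable (at x)) \<and>
     grad \<Phi> ` D = UNIV \<and>
     (\<forall>z\<in>frontier D. filterlim (\<lambda>x. norm (grad \<Phi> x)) at_top (at z within D))"

definition bregman :: "('a::euclidean_space \<Rightarrow> real) \<Rightarrow> 'a \<Rightarrow> 'a \<Rightarrow> real" where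
  "bregman \<Phi> x y = \<Phi> x - \<Phi> y - grad \<Phi> y \<bullet> (x - y)"

(* The extrapolated points are \<zeta> 1, \<zeta> 2, ...; the value \<zeta> 0 plays no role. *)
definition mirror_prox ::
  "'a::euclidean_space set \<Rightarrow> 'a set \<Rightarrow> ('a \<Rightarrow> real) \<Rightarrow> ('a \<Rightarrow> real) \<Rightarrow> real \<Rightarrow>
   (nat \<Rightarrow> 'a) \<Rightarrow> (nat \<Rightarrow> 'a) \<Rightarrow> bool" where
  "mirror_prox C D \<Phi> f \<eta> \<zeta> \<theta> \<longleftrightarrow>
     \<theta> 0 \<in> C \<inter> D \<and>
     (\<forall>n. is_arg_min (\<lambda>x. \<eta> * (grad f (\<theta> n) \<bullet> x) + bregman \<Phi> x (\<theta> n))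
                     (\<lambda>x. x \<in> C \<inter> D) (\<zeta> (Suc n)) \<and>
          is_arg_min (\<lambda>x. \<eta> * (grad f (\<zeta> (Suc n)) \<bullet> x) + bregman \<Phi> x (\<theta> n))
                     (\<lambda>x. x \<in> C \<inter> D) (\<theta> (Suc n)))"

end

theory Submission
  imports Defs
begin

text \<open>The Lyapunov function \<open>V n = bregman \<Phi> \<theta>s (\<theta> n)\<close> contracts. The three-point identity at
both arg-min steps, combined with smoothness and strong convexity, gives
\<open>V (Suc n) \<le> V n - \<eta> * (grad f z \<bullet> (z - \<theta>s)) - c * (norm (z - \<theta> n))\<^sup>2\<close> with \<open>z = \<zeta> (Suc n)\<close> and
\<open>c > 0\<close>. Compactness and monotonicity of the gradient make the local information at \<open>\<theta>s\<close> global on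
\<open>C\<close>: positivity of the Hessian yields \<open>grad f z \<bullet> (z - \<theta>s) \<ge> m * (norm (z - \<theta>s))\<^sup>2\<close>, and
differentiability of \<open>grad \<Phi>\<close> yields \<open>V n \<le> L * (norm (\<theta> n - \<theta>s))\<^sup>2\<close>. Hence the decrease is at
least a fixed fraction of \<open>V n\<close>, so \<open>V\<close> decays geometrically, and by strong convexity so does the
squared distance to \<open>\<theta>s\<close>.\<close>

section \<open>First-order conditions along segments\<close>

lemma has_derivative_along_segment:
  fixes h :: "'a::euclidean_space \<Rightarrow> real"
  assumes "(h has_derivative h') (at x)"
  shows "((\<lambda>t. h (x + t *\<^sub>R v)) has_real_derivative h' v) (at 0)"
proof -
  have "((\<lambda>t. x + t *\<^sub>R v) has_derivative (\<lambda>t. t *\<^sub>R v)) (at 0)"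
    by (auto intro!: derivative_eq_intros)
  moreover have "(h has_derivative h') (at (x + 0 *\<^sub>R v))"
    using assms by simp
  ultimately have "((\<lambda>t. h (x + t *\<^sub>R v)) has_derivative (\<lambda>t. h' (t *\<^sub>R v))) (at 0)"
    by (rule has_derivative_compose)
  moreover have "(\<lambda>t. h' (t *\<^sub>R v)) = (*) (h' v)"
    using linear_scale[OF has_derivative_linear[OF assms]] by (auto simp: fun_eq_iff)
  ultimately show ?thesis
    by (simp add: has_field_derivative_def)
qed

lemma convex_point_along_segment:
  fixes x :: "'a::real_vector"
  assumes "convex C" "x \<in> C" "y \<in> C" "0 \<le> t" "t \<le> 1"
  shows "x + t *\<^sub>R (y - x) \<in> C"
proof -
  have "x + t *\<^sub>R (y - x) = (1 - t) *\<^sub>R x + t *\<^sub>R y"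
    by (simp add: algebra_simps)
  then show ?thesis
    using assms convexD_alt[of C x y t] by simp
qed

text \<open>A negative derivative in the direction of \<open>y\<close> would let a short step along
  the segment, which stays in \<open>C\<close> by convexity, go below the minimum.\<close>

lemma is_arg_min_variational_inequality:
  fixes h :: "'a::euclidean_space \<Rightarrow> real"
  assumes "convex C" "is_arg_min h (\<lambda>x. x \<in> C) x" "(h has_derivative h') (at x)" "y \<in> C"
  shows "h' (y - x) \<ge> 0"
proof (rule ccontr)
  assume "\<not> h' (y - x) \<ge> 0"
  then obtain d where d: "d > 0"
      "\<And>t. t > 0 \<Longrightarrow> t < d \<Longrightarrow> h (x + (0 + t) *\<^sub>R (y - x)) < h (x + 0 *\<^sub>R (y - x))"
    using DERIV_neg_dec_right[OF has_derivative_along_segment[OF assms(3), of "y - x"]] by force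
  \<comment> \<open>Halving \<open>d\<close> gives the strict bound \<open>t < d\<close>; the cap at
    1 keeps the point on the segment.\<close>
  define t where "t = min (d/2) 1"
  have t: "t > 0" "t < d" "t \<le> 1"
    using d(1) by (auto simp: t_def)
  have "h (x + t *\<^sub>R (y - x)) < h x"
    using d(2)[OF t(1,2)] by simp
  moreover have "x + t *\<^sub>R (y - x) \<in> C"
    using convex_point_along_segment[OF assms(1) _ assms(4)] assms(2) t by (auto simp: is_arg_min_def)
  ultimately show False
    using assms(2) by (auto simp: is_arg_min_def)
qed

text \<open>Subtracting the slope of the chord from \<open>f\<close> along the segment gives \<phi>.
  A failure of the tangent bound makes \<phi> increase at 0, whereas convexity keeps \<phi> below
  its value there. Differentiability is used at the point \<open>x\<close> alone.\<close>

lemma convex_on_above_tangent: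
  fixes f :: "'a::euclidean_space \<Rightarrow> real"
  assumes "convex_on C f" "(f has_derivative f') (at x)" "x \<in> C" "y \<in> C"
  shows "f y \<ge> f x + f' (y - x)"
proof (rule ccontr)
  assume neg: "\<not> f y \<ge> f x + f' (y - x)"
  define \<phi> where "\<phi> = (\<lambda>t. f (x + t *\<^sub>R (y - x)) - t * (f y - f x))"
  have "(\<phi> has_real_derivative f' (y - x) - (f y - f x)) (at 0)"
    unfolding \<phi>_def
    by (auto intro!: derivative_eq_intros has_derivative_along_segment[OF assms(2)])
  from DERIV_pos_inc_right[OF this] neg
  obtain d where d: "d > 0" "\<And>t. t > 0 \<Longrightarrow> t < d \<Longrightarrow> \<phi> 0 < \<phi> (0 + t)"
    by force
  define t where "t = min (d/2) 1"
  have t: "t > 0" "t < d" "t \<le> 1"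
    using d(1) by (auto simp: t_def)
  have "x + t *\<^sub>R (y - x) = (1 - t) *\<^sub>R x + t *\<^sub>R y"
    by (simp add: algebra_simps)
  then have "f (x + t *\<^sub>R (y - x)) \<le> (1 - t) * f x + t * f y"
    using convex_onD[OF assms(1), of t x y] t assms by auto
  then have "\<phi> t \<le> \<phi> 0"
    by (simp add: \<phi>_def algebra_simps)
  with d(2)[OF t(1,2)] show False by simp
qed

lemma has_derivative_grad:
  fixes f :: "'a::euclidean_space \<Rightarrow> real"
  assumes "f differentiable (at x)"
  shows "(f has_derivative (\<lambda>h. h \<bullet> grad f x)) (at x)"
  using GDERIV_grad[OF assms] by (simp add: gderiv_def)

section \<open>From local information to bounds on the whole set\<close>

text \<open>Near \<open>x0\<close> the derivative controls the increment. At distance at least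
  \<open>d\<close>, the boundedness of \<open>F\<close> on the compact set suffices, because a
  constant is then at most a multiple of the distance. This replaces a Lipschitz bound on
  \<open>grad \<Phi>\<close>.\<close>

lemma linear_growth_of_differentiable_at:
  fixes F :: "'a::euclidean_space \<Rightarrow> 'b::euclidean_space"
  assumes "compact S" "continuous_on S F" "F differentiable (at x0)"
  obtains L where "L > 0" "\<And>x. x \<in> S \<Longrightarrow> norm (F x - F x0) \<le> L * norm (x - x0)"
proof -
  obtain F' where F': "(F has_derivative F') (at x0)"
    using assms(3) unfolding differentiable_def by blast
  obtain K where K: "\<And>h. norm (F' h) \<le> norm h * K"
    using has_derivative_bounded_linear[OF F'] bounded_linear.bounded by blast
  obtain d where d: "d > 0"
      "\<And>x. norm (x - x0) < d \<Longrightarrow> norm (F x - F x0 - F' (x - x0)) \<le> 1 * norm (x - x0)"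
    using F' unfolding has_derivative_at_alt by (metis zero_less_one)
  have "bounded (F ` S)"
    using assms compact_continuous_image compact_imp_bounded by blast
  then obtain B where B: "\<And>x. x \<in> S \<Longrightarrow> norm (F x) \<le> B"
    unfolding bounded_iff by blast
  define M where "M = \<bar>B\<bar> + norm (F x0)"
  \<comment> \<open>The summands \<open>\<bar>K\<bar> + 1\<close> serve the points near
    \<open>x0\<close>, and \<open>M / d\<close> the remote ones.\<close>
  define L where "L = \<bar>K\<bar> + 1 + M / d"
  have M0: "M \<ge> 0" by (simp add: M_def)
  show ?thesis
  proof
    show "L > 0"
      using M0 d(1) by (simp add: L_def add_pos_nonneg)
    fix x assume x: "x \<in> S"
    show "norm (F x - F x0) \<le> L * norm (x - x0)"
    proof (cases "norm (x - x0) < d")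
      case True
      have "norm (F x - F x0) \<le> norm (F x - F x0 - F' (x - x0)) + norm (F' (x - x0))"
        by (metis diff_add_cancel norm_triangle_ineq)
      also have "\<dots> \<le> norm (x - x0) + norm (x - x0) * K"
        using d(2)[OF True] K[of "x - x0"] by simp
      also have "\<dots> = (1 + K) * norm (x - x0)"
        by (simp add: algebra_simps)
      also have "\<dots> \<le> L * norm (x - x0)"
        using M0 d(1) by (intro mult_right_mono) (auto simp: L_def add_increasing2)
      finally show ?thesis .
    next
      case False
      have "norm (F x - F x0) \<le> norm (F x) + norm (F x0)"
        by (rule norm_triangle_ineq4)
      also have "\<dots> \<le> M / d * d"
        using B[OF x] d(1) by (simp add: M_def)
      also have "\<dots> \<le> M / d * norm (x - x0)"
        using False M0 d(1) by (intro mult_left_mono) auto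
      also have "\<dots> \<le> L * norm (x - x0)"
        by (intro mult_right_mono) (auto simp: L_def)
      finally show ?thesis .
    qed
  qed
qed

text \<open>The quadratic form attains a positive minimum on the compact unit sphere of
  \<open>V\<close>; homogeneity of degree 2 extends the bound to all of \<open>V\<close>.\<close>

lemma positive_definite_on_subspace_coercive:
  fixes A :: "real^'n^'n"
  assumes "subspace V" "\<And>v. v \<in> V \<Longrightarrow> v \<noteq> 0 \<Longrightarrow> v \<bullet> (A *v v) > 0"
  shows "\<exists>\<mu>>0. \<forall>v\<in>V. \<mu> * (norm v)\<^sup>2 \<le> v \<bullet> (A *v v)"
proof -
  define S where "S = sphere 0 1 \<inter> V"
  have "compact S"
    unfolding S_def using closed_subspace[OF assms(1)] by (intro compact_Int_closed) auto
  moreover have "continuous_on S (\<lambda>v. v \<bullet> (A *v v))"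
    by (intro continuous_on_inner continuous_on_id matrix_vector_mult_linear_continuous_on)
  ultimately have "\<exists>\<mu>>0. \<forall>v\<in>S. \<mu> \<le> v \<bullet> (A *v v)"
  proof (cases "S = {}")
    case False
    with continuous_attains_inf[OF \<open>compact S\<close> False \<open>continuous_on S _\<close>]
    obtain u where u: "u \<in> S" "\<And>v. v \<in> S \<Longrightarrow> u \<bullet> (A *v u) \<le> v \<bullet> (A *v v)"
      by blast
    moreover have "u \<bullet> (A *v u) > 0"
      using u(1) by (intro assms(2)) (auto simp: S_def)
    ultimately show ?thesis by blast
  \<comment> \<open>An empty sphere means that \<open>V\<close> is trivial, so any positive constant
    will do.\<close>
  qed (auto intro: exI[of _ 1])
  then obtain \<mu> where \<mu>: "\<mu> > 0" "\<And>v. v \<in> S \<Longrightarrow> \<mu> \<le> v \<bullet> (A *v v)"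
    by blast
  show ?thesis
  proof (intro exI conjI ballI)
    show "\<mu> > 0" by fact
    fix v assume v: "v \<in> V"
    show "\<mu> * (norm v)\<^sup>2 \<le> v \<bullet> (A *v v)"
    proof (cases "v = 0")
      case False
      define u where "u = (1 / norm v) *\<^sub>R v"
      have "u \<in> S"
        using False v assms(1) by (auto simp: S_def u_def subspace_scale)
      then have "\<mu> * (norm v)\<^sup>2 \<le> (u \<bullet> (A *v u)) * (norm v)\<^sup>2"
        by (intro mult_right_mono \<mu>) auto
      also have "\<dots> = v \<bullet> (A *v v)"
        using False by (simp add: u_def matrix_vector_mult_scaleR power2_eq_square)
      finally show ?thesis .
    qed simp
  qed
qed

text \<open>Near \<open>x0\<close>, linearising the gradient gives the bound, the term
  \<open>grad f x0\<close> having the right sign by optimality. Further out, monotonicity of the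
  gradient carries the bound outwards along the segment. There it grows only linearly in the
  distance, which is enough because \<open>C\<close> is bounded.\<close>

lemma quadratic_growth_of_gradient_at_arg_min:
  fixes f :: "'a::euclidean_space \<Rightarrow> real"
  assumes C: "convex C" "bounded C" and f: "convex_on C f"
    and diff: "\<And>x. x \<in> C \<Longrightarrow> f differentiable (at x)"
    and min: "is_arg_min f (\<lambda>x. x \<in> C) x0"
    and H: "(grad f has_derivative H) (at x0)"
    and \<mu>: "\<mu> > 0" "\<And>x. x \<in> C \<Longrightarrow> \<mu> * (norm (x - x0))\<^sup>2 \<le> (x - x0) \<bullet> H (x - x0)"
  obtains m where "m > 0" "\<And>x. x \<in> C \<Longrightarrow> m * (norm (x - x0))\<^sup>2 \<le> grad f x \<bullet> (x - x0)"
proof -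
  have x0: "x0 \<in> C"
    using min by (simp add: is_arg_min_def)
  have first_order: "grad f x0 \<bullet> (x - x0) \<ge> 0" if "x \<in> C" for x
    using is_arg_min_variational_inequality[OF C(1) min has_derivative_grad[OF diff[OF x0]] that]
    by (simp add: inner_commute)
  have tangent: "f y \<ge> f x + grad f x \<bullet> (y - x)" if "x \<in> C" "y \<in> C" for x y
    using convex_on_above_tangent[OF f has_derivative_grad[OF diff] that] that
    by (simp add: inner_commute)
  have mono: "(grad f y - grad f x) \<bullet> (y - x) \<ge> 0" if "x \<in> C" "y \<in> C" for x y
    using tangent[OF that] tangent[OF that(2,1)] by (simp add: inner_diff)
  \<comment> \<open>The tolerance \<open>\<mu>/2\<close> leaves half of the coercivity constant
    after linearisation.\<close>
  obtain d where d: "d > 0"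
      "\<And>x. norm (x - x0) < d \<Longrightarrow>
        norm (grad f x - grad f x0 - H (x - x0)) \<le> (\<mu>/2) * norm (x - x0)"
    using H \<mu>(1) unfolding has_derivative_at_alt by (metis half_gt_zero)
  have local: "\<mu>/2 * (norm (x - x0))\<^sup>2 \<le> grad f x \<bullet> (x - x0)"
    if x: "x \<in> C" "norm (x - x0) < d" for x
  proof -
    have "\<bar>(grad f x - grad f x0 - H (x - x0)) \<bullet> (x - x0)\<bar>
        \<le> norm (grad f x - grad f x0 - H (x - x0)) * norm (x - x0)"
      by (rule Cauchy_Schwarz_ineq2)
    also have "\<dots> \<le> (\<mu>/2 * norm (x - x0)) * norm (x - x0)"
      by (intro mult_right_mono d x) auto
    finally have "\<bar>(grad f x - grad f x0 - H (x - x0)) \<bullet> (x - x0)\<bar> \<le> \<mu>/2 * (norm (x - x0))\<^sup>2"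
      by (simp add: power2_eq_square)
    moreover have "(grad f x - grad f x0 - H (x - x0)) \<bullet> (x - x0)
        = grad f x \<bullet> (x - x0) - grad f x0 \<bullet> (x - x0) - (x - x0) \<bullet> H (x - x0)"
      by (simp add: inner_diff_left inner_diff_right inner_commute)
    ultimately show ?thesis
      using first_order[OF x(1)] \<mu>(2)[OF x(1)] by linarith
  qed
  obtain B where B: "B > 0" "\<And>x. x \<in> C \<Longrightarrow> norm (x - x0) \<le> B"
  proof -
    have "bounded ((\<lambda>x. x - x0) ` C)"
      using C(2) by (rule bounded_translation_minus)
    then show ?thesis
      using that unfolding bounded_pos by auto
  qed
  define r where "r = d / 2"
  have r: "r > 0" "r < d"
    using d(1) by (auto simp: r_def)
  \<comment> \<open>The first entry is the local constant. The second lowers the linear bound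
    \<open>\<mu>/2 * r * n\<close> to a quadratic one through \<open>n / B \<le> 1\<close>.\<close>
  define m where "m = min (\<mu>/2) (\<mu>/2 * r / B)"
  show ?thesis
  proof
    show "m > 0"
      using \<mu>(1) r B(1) by (auto simp: m_def)
    fix x assume x: "x \<in> C"
    define n where "n = norm (x - x0)"
    show "m * (norm (x - x0))\<^sup>2 \<le> grad f x \<bullet> (x - x0)"
    proof (cases "n \<le> r")
      case True
      have "m * (norm (x - x0))\<^sup>2 \<le> \<mu>/2 * (norm (x - x0))\<^sup>2"
        by (intro mult_right_mono) (auto simp: m_def)
      then show ?thesis
        using local[OF x] True r by (simp add: n_def)
    next
      case False
      \<comment> \<open>Compare with the point of the segment at distance \<open>r\<close> from \<open>x0\<close>.\<close>
      define t where "t = r / n"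
      define y where "y = x0 + t *\<^sub>R (x - x0)"
      have n: "n > r" "n > 0" "n \<le> B"
        using False r B(2)[OF x] by (auto simp: n_def)
      have t: "0 < t" "t < 1"
        using n r by (auto simp: t_def)
      have y: "y \<in> C"
        unfolding y_def using convex_point_along_segment[OF C(1) x0 x] t by auto
      have yn: "norm (y - x0) = r"
        using t n r by (simp add: y_def n_def[symmetric] t_def)
      have "\<mu>/2 * r\<^sup>2 \<le> grad f y \<bullet> (t *\<^sub>R (x - x0))"
        using local[OF y] yn r by (simp add: y_def)
      then have a: "\<mu>/2 * r\<^sup>2 \<le> t * (grad f y \<bullet> (x - x0))"
        by simp
      \<comment> \<open>As \<open>x - y\<close> is a positive multiple of \<open>x - x0\<close>,
        monotonicity compares the two gradients in the direction \<open>x - x0\<close>.\<close>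
      have "x - y = (1 - t) *\<^sub>R (x - x0)"
        by (simp add: y_def algebra_simps)
      then have "(1 - t) * ((grad f x - grad f y) \<bullet> (x - x0)) \<ge> 0"
        using mono[OF y x] by simp
      then have b: "grad f y \<bullet> (x - x0) \<le> grad f x \<bullet> (x - x0)"
        using t by (simp add: zero_le_mult_iff inner_diff_left)
      have "t * (\<mu>/2 * r * n) = \<mu>/2 * r\<^sup>2"
        using n by (simp add: t_def power2_eq_square)
      with a have c: "\<mu>/2 * r * n \<le> grad f y \<bullet> (x - x0)"
        using t mult_le_cancel_left_pos by metis
      have "m * n\<^sup>2 \<le> (\<mu>/2 * r / B) * n\<^sup>2"
        by (intro mult_right_mono) (auto simp: m_def)
      also have "\<dots> = \<mu>/2 * r * n * (n / B)"
        by (simp add: power2_eq_square)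
      also have "\<dots> \<le> \<mu>/2 * r * n * 1"
        using n B \<mu>(1) r by (intro mult_left_mono) auto
      finally show ?thesis
        using b c by (simp add: n_def)
    qed
  qed
qed

section \<open>Bregman divergences and one mirror prox step\<close>

lemma bregman_three_points:
  "bregman \<Phi> x w - bregman \<Phi> x u - bregman \<Phi> u w = (grad \<Phi> u - grad \<Phi> w) \<bullet> (x - u)"
  by (simp add: bregman_def inner_diff algebra_simps)

text \<open>This is the variational inequality at the minimizer \<open>u\<close>, with the gradient
  difference of \<Phi> rewritten by the three-point identity.\<close>

lemma mirror_step_inequality:
  fixes C :: "'a::euclidean_space set"
  assumes "convex C" "\<Phi> differentiable (at u)" "x \<in> C"
    and "is_arg_min (\<lambda>y. \<eta> * (g \<bullet> y) + bregman \<Phi> y w) (\<lambda>y. y \<in> C) u"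
  shows "\<eta> * (g \<bullet> (u - x)) \<le> bregman \<Phi> x w - bregman \<Phi> x u - bregman \<Phi> u w"
proof -
  have "((\<lambda>y. \<eta> * (g \<bullet> y) + bregman \<Phi> y w) has_derivative
      (\<lambda>h. \<eta> * (g \<bullet> h) + (h \<bullet> grad \<Phi> u - grad \<Phi> w \<bullet> h))) (at u)"
    unfolding bregman_def
    by (auto intro!: derivative_eq_intros has_derivative_grad[OF assms(2)])
  from is_arg_min_variational_inequality[OF assms(1,4) this assms(3)]
  show ?thesis
    unfolding bregman_three_points by (simp add: inner_diff inner_commute algebra_simps)
qed

text \<open>The product \<open>grad f z \<bullet> (z - x)\<close> splits into the optimality terms
  of the two steps and an error from replacing \<open>grad f w\<close> by \<open>grad f z\<close>.
  Strong convexity supplies negative quadratic terms that absorb this error.\<close>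

lemma mirror_prox_step_descent:
  fixes C :: "'a::euclidean_space set"
  assumes "convex C" "\<And>y. y \<in> C \<Longrightarrow> \<Phi> differentiable (at y)" "x \<in> C" "w \<in> C"
    and "strongly_convex_on C \<gamma> \<Phi>" "smooth_grad_on C \<beta> f" "\<eta> > 0" "\<eta> * \<beta> \<le> \<gamma>" "\<beta> > 0"
    and z: "is_arg_min (\<lambda>y. \<eta> * (grad f w \<bullet> y) + bregman \<Phi> y w) (\<lambda>y. y \<in> C) z"
    and u: "is_arg_min (\<lambda>y. \<eta> * (grad f z \<bullet> y) + bregman \<Phi> y w) (\<lambda>y. y \<in> C) u"
  shows "bregman \<Phi> x u \<le> bregman \<Phi> x w - \<eta> * (grad f z \<bullet> (z - x))
           - (\<gamma> - \<eta> * \<beta>) / 2 * (norm (z - w))\<^sup>2"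
proof -
  have zu: "z \<in> C" "u \<in> C"
    using z u by (auto simp: is_arg_min_def)
  define a where "a = norm (z - w)"
  define b where "b = norm (z - u)"
  \<comment> \<open>The extrapolation step is tested against the next iterate \<open>u\<close>, the
    second step against \<open>x\<close>; \<open>bregman \<Phi> u w\<close> then cancels in the
    sum.\<close>
  have "\<eta> * (grad f w \<bullet> (z - u)) \<le> bregman \<Phi> u w - bregman \<Phi> u z - bregman \<Phi> z w"
    using mirror_step_inequality[OF assms(1) assms(2) _ z] zu by blast
  moreover have "\<eta> * (grad f z \<bullet> (u - x)) \<le> bregman \<Phi> x w - bregman \<Phi> x u - bregman \<Phi> u w"
    using mirror_step_inequality[OF assms(1) assms(2) _ u] zu assms(3) by blast
  moreover have "bregman \<Phi> u z \<ge> \<gamma> / 2 * b\<^sup>2" "bregman \<Phi> z w \<ge> \<gamma> / 2 * a\<^sup>2"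
    using assms(5) zu assms(4) unfolding strongly_convex_on_def bregman_def a_def b_def
    by (auto simp: norm_minus_commute algebra_simps)
  \<comment> \<open>Splitting the product of \<open>a\<close> and \<open>b\<close> into squares
    matches the error with the two strong convexity terms.\<close>
  moreover have "\<eta> * ((grad f z - grad f w) \<bullet> (z - u)) \<le> \<eta> * \<beta> / 2 * (a\<^sup>2 + b\<^sup>2)"
  proof -
    have "(grad f z - grad f w) \<bullet> (z - u) \<le> norm (grad f z - grad f w) * b"
      unfolding b_def by (rule norm_cauchy_schwarz)
    also have "\<dots> \<le> \<beta> * a * b"
      using assms(4,6) zu unfolding smooth_grad_on_def a_def b_def by (intro mult_right_mono) auto
    also have "\<dots> \<le> \<beta> * ((a\<^sup>2 + b\<^sup>2) / 2)"
      using sum_squares_bound[of a b] assms(9) by (simp add: mult.assoc)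
    finally show ?thesis
      using mult_left_mono[of _ _ \<eta>] assms(7) by fastforce
  qed
  moreover have "\<eta> * (grad f z \<bullet> (z - x)) = \<eta> * ((grad f z - grad f w) \<bullet> (z - u))
      + \<eta> * (grad f w \<bullet> (z - u)) + \<eta> * (grad f z \<bullet> (u - x))"
    by (simp add: inner_diff algebra_simps)
  moreover have "(\<gamma> - \<eta> * \<beta>) / 2 * a\<^sup>2 + (\<gamma> - \<eta> * \<beta>) / 2 * b\<^sup>2
      = \<gamma> / 2 * b\<^sup>2 + \<gamma> / 2 * a\<^sup>2 - \<eta> * \<beta> / 2 * (a\<^sup>2 + b\<^sup>2)"
    by (simp add: field_simps)
  moreover have "(\<gamma> - \<eta> * \<beta>) / 2 * b\<^sup>2 \<ge> 0"
    using assms(8) by simp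
  ultimately show ?thesis
    unfolding a_def[symmetric] by linarith
qed

text \<open>Adding the nonnegative divergence with the arguments swapped cancels the values of
  \<Phi> and leaves an inner product with the gradient difference.\<close>

lemma bregman_le_gradient_difference:
  assumes "strongly_convex_on C \<gamma> \<Phi>" "\<gamma> \<ge> 0" "x \<in> C" "y \<in> C"
  shows "bregman \<Phi> x y \<le> norm (grad \<Phi> y - grad \<Phi> x) * norm (y - x)"
proof -
  have "0 \<le> \<gamma> / 2 * (norm (y - x))\<^sup>2"
    using assms(2) by simp
  moreover have "\<Phi> y \<ge> \<Phi> x + grad \<Phi> x \<bullet> (y - x) + \<gamma> / 2 * (norm (y - x))\<^sup>2"
    using assms unfolding strongly_convex_on_def by blast
  ultimately have "bregman \<Phi> x y \<le> (grad \<Phi> y - grad \<Phi> x) \<bullet> (y - x)"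
    by (simp add: bregman_def inner_diff)
  also have "\<dots> \<le> norm (grad \<Phi> y - grad \<Phi> x) * norm (y - x)"
    by (rule norm_cauchy_schwarz)
  finally show ?thesis .
qed

section \<open>Squared distances and geometric rates\<close>

lemma norm_diff_squared_le:
  fixes w x z :: "'a::real_inner"
  shows "(norm (w - x))\<^sup>2 \<le> 2 * ((norm (z - x))\<^sup>2 + (norm (z - w))\<^sup>2)"
proof -
  have "norm (w - x) \<le> norm (z - x) + norm (z - w)"
    using norm_triangle_ineq4[of "z - x" "z - w"] by simp
  then have "(norm (w - x))\<^sup>2 \<le> (norm (z - x) + norm (z - w))\<^sup>2"
    by (intro power_mono) auto
  also have "\<dots> \<le> 2 * ((norm (z - x))\<^sup>2 + (norm (z - w))\<^sup>2)"
    using sum_squares_bound[of "norm (z - x)" "norm (z - w)"] by (simp add: power2_sum)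
  finally show ?thesis .
qed

text \<open>The bound on the square makes \<open>e\<close> decay at rate \<open>sqrt q\<close>; any
  \<rho> strictly between \<open>sqrt q\<close> and 1, here the midpoint, improves big-O to
  little-o.\<close>

lemma geometric_bound_imp_smallo:
  fixes e :: "nat \<Rightarrow> real"
  assumes "0 \<le> q" "q < 1" "\<And>n. (e n)\<^sup>2 \<le> A * q ^ n"
  shows "\<exists>\<rho>. 0 < \<rho> \<and> \<rho> < 1 \<and> e \<in> o(\<lambda>n. \<rho> ^ n)"
proof -
  define s where "s = sqrt q"
  define \<rho> where "\<rho> = (s + 1) / 2"
  have s: "0 \<le> s" "s < 1"
    using assms by (auto simp: s_def)
  then have \<rho>: "0 < \<rho>" "\<rho> < 1" "s < \<rho>"
    by (auto simp: \<rho>_def)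
  have e_bound: "\<bar>e n\<bar> \<le> sqrt A * s ^ n" for n
  proof -
    have "\<bar>e n\<bar> = sqrt ((e n)\<^sup>2)"
      by simp
    also have "\<dots> \<le> sqrt (A * q ^ n)"
      by (intro real_sqrt_le_mono assms)
    also have "\<dots> = sqrt A * s ^ n"
      by (simp add: s_def real_sqrt_mult real_sqrt_power)
    finally show ?thesis .
  qed
  have "norm (e n / \<rho> ^ n) \<le> sqrt A * (s / \<rho>) ^ n" for n
  proof -
    have "norm (e n / \<rho> ^ n) = \<bar>e n\<bar> / \<rho> ^ n"
      using \<rho> by simp
    also have "\<dots> \<le> sqrt A * s ^ n / \<rho> ^ n"
      using \<rho> by (intro divide_right_mono e_bound) auto
    finally show ?thesis by (simp add: power_divide)
  qed
  moreover have "(\<lambda>n. sqrt A * (s / \<rho>) ^ n) \<longlonglongrightarrow> sqrt A * 0"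
    using s \<rho> by (intro tendsto_mult tendsto_const LIMSEQ_power_zero) auto
  ultimately have "(\<lambda>n. e n / \<rho> ^ n) \<longlonglongrightarrow> 0"
    using Lim_null_comparison[of "\<lambda>n. e n / \<rho> ^ n" "\<lambda>n. sqrt A * (s / \<rho>) ^ n"] by simp
  then have "e \<in> o(\<lambda>n. \<rho> ^ n)"
    using \<rho> by (intro smalloI_tendsto) auto
  with \<rho> show ?thesis by blast
qed

section \<open>Contraction of the Lyapunov function\<close>

theorem theorem7:
  fixes C D :: "(real^'q) set"
    and f \<Phi> :: "real^'q \<Rightarrow> real"
    and \<eta> \<gamma> \<beta> :: real
    and \<theta>s :: "real^'q"
    and \<zeta> \<theta> :: "nat \<Rightarrow> real^'q"
  assumes "convex C" and "compact C"
    and "convex D" and "open D"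
    and "C \<subseteq> closure D" and "C \<inter> D \<noteq> {}"
    and "mirror_map D \<Phi>"
    and "\<eta> > 0" and "\<gamma> > 0" and "\<beta> > 0"
    and "\<theta>s \<in> C"
    and "C \<subseteq> D"
    and "\<forall>x\<in>C. twice_differentiable_at \<Phi> x"
    and "\<forall>x\<in>C. twice_differentiable_at f x"
    and "C2_on_nbhd \<Phi> \<theta>s" and "C2_on_nbhd f \<theta>s"
    and "strongly_convex_on C \<gamma> \<Phi>"
    and "convex_on C f" and "smooth_grad_on C \<beta> f"
    and "\<eta> < \<gamma> / \<beta>"
    and "\<forall>x. is_arg_min f (\<lambda>y. y \<in> C) x \<longleftrightarrow> x = \<theta>s"
    and "\<theta>s \<in> rel_interior C"
    and "\<forall>v \<in> span {x - y | x y. x \<in> C \<and> y \<in> C}. v \<noteq> 0 \<longrightarrow> v \<bullet> (hessian f \<theta>s *v v) > 0"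
    and "mirror_prox C D \<Phi> f \<eta> \<zeta> \<theta>"
  shows "\<theta> \<longlonglongrightarrow> \<theta>s \<and>
         (\<exists>\<rho>. 0 < \<rho> \<and> \<rho> < 1 \<and> (\<lambda>n. norm (\<theta> n - \<theta>s)) \<in> o(\<lambda>n. \<rho> ^ n))"
proof -
  note C = assms(1,2) and CD = assms(12) and eta = assms(8) and gam = assms(9) and bet = assms(10)
  note ts = assms(11) and sc = assms(17)
  have \<Phi>_diff: "\<Phi> differentiable (at x)" and f_diff: "f differentiable (at x)"
    and d\<Phi>: "grad \<Phi> differentiable (at x)" and df: "grad f differentiable (at x)" if "x \<in> C" for x
    using assms(13,14) that unfolding twice_differentiable_at_def
    by (blast dest: eventually_nhds_x_imp_x)+
  have "continuous_on C (grad \<Phi>)"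
    using d\<Phi> differentiable_imp_continuous_within continuous_at_imp_continuous_on by blast
  from linear_growth_of_differentiable_at[OF C(2) this d\<Phi>[OF ts]]
  obtain L where L: "L > 0"
    "\<And>x. x \<in> C \<Longrightarrow> norm (grad \<Phi> x - grad \<Phi> \<theta>s) \<le> L * norm (x - \<theta>s)"
    by blast
  have breg_upper: "bregman \<Phi> \<theta>s x \<le> L * (norm (x - \<theta>s))\<^sup>2" if "x \<in> C" for x
  proof -
    have "bregman \<Phi> \<theta>s x \<le> norm (grad \<Phi> x - grad \<Phi> \<theta>s) * norm (x - \<theta>s)"
      using bregman_le_gradient_difference[OF sc _ ts that] gam by simp
    also have "\<dots> \<le> L * norm (x - \<theta>s) * norm (x - \<theta>s)"
      by (intro mult_right_mono L that) auto
    finally show ?thesis by (simp add: power2_eq_square)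
  qed
  have breg_lower: "\<gamma> / 2 * (norm (x - \<theta>s))\<^sup>2 \<le> bregman \<Phi> \<theta>s x" if "x \<in> C" for x
    using sc that ts unfolding strongly_convex_on_def bregman_def
    by (auto simp: norm_minus_commute algebra_simps)

  have min: "is_arg_min f (\<lambda>y. y \<in> C) \<theta>s"
    using assms(21) by blast
  obtain \<mu> where \<mu>: "\<mu> > 0"
    "\<forall>v \<in> span {x - y | x y. x \<in> C \<and> y \<in> C}. \<mu> * (norm v)\<^sup>2 \<le> v \<bullet> (hessian f \<theta>s *v v)"
    using positive_definite_on_subspace_coercive[OF subspace_span assms(23)[rule_format]] by blast
  have H: "(grad f has_derivative (\<lambda>h. hessian f \<theta>s *v h)) (at \<theta>s)"
    using df[OF ts] unfolding hessian_def by (simp add: jacobian_works)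
  \<comment> \<open>Both points lie in \<open>C\<close>, so \<open>x - \<theta>s\<close> is one of
    the generators of the span.\<close>
  have H_coercive: "\<mu> * (norm (x - \<theta>s))\<^sup>2 \<le> (x - \<theta>s) \<bullet> (hessian f \<theta>s *v (x - \<theta>s))" if "x \<in> C" for x
    using that ts by (intro \<mu>(2)[rule_format] span_base) blast
  from quadratic_growth_of_gradient_at_arg_min
      [OF C(1) compact_imp_bounded[OF C(2)] assms(18) f_diff min H \<mu>(1) H_coercive]
  obtain m where m: "m > 0"
    "\<And>x. x \<in> C \<Longrightarrow> m * (norm (x - \<theta>s))\<^sup>2 \<le> grad f x \<bullet> (x - \<theta>s)"
    by blast

  have "C \<inter> D = C"
    using CD by blast
  then have prox: "\<theta> 0 \<in> C"
    "\<And>n. is_arg_min (\<lambda>x. \<eta> * (grad f (\<theta> n) \<bullet> x) + bregman \<Phi> x (\<theta> n)) (\<lambda>x. x \<in> C) (\<zeta> (Suc n))"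
    "\<And>n. is_arg_min (\<lambda>x. \<eta> * (grad f (\<zeta> (Suc n)) \<bullet> x) + bregman \<Phi> x (\<theta> n)) (\<lambda>x. x \<in> C) (\<theta> (Suc n))"
    using assms(24) unfolding mirror_prox_def by auto
  have \<theta>C: "\<theta> n \<in> C" for n
    using prox(1,3) by (cases n) (auto simp: is_arg_min_def)
  have \<zeta>C: "\<zeta> (Suc n) \<in> C" for n
    using prox(2) by (auto simp: is_arg_min_def)

  define c where "c = (\<gamma> - \<eta> * \<beta>) / 2"
  have eb: "\<eta> * \<beta> < \<gamma>"
    using assms(20) bet by (simp add: field_simps)
  then have c: "c > 0"
    by (simp add: c_def)
  define V where "V = (\<lambda>n. bregman \<Phi> \<theta>s (\<theta> n))"
  \<comment> \<open>A common coefficient for both decrease terms: each step lowers \<open>V\<close>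
    by at least \<open>k * (P + Q)\<close>, in the notation of the contraction below.\<close>
  define k where "k = min (\<eta> * m) c"
  have k: "k > 0"
    using eta m(1) c by (simp add: k_def)
  have V0: "V n \<ge> 0" for n
  proof -
    have "0 \<le> \<gamma> / 2 * (norm (\<theta> n - \<theta>s))\<^sup>2"
      using gam by simp
    then show ?thesis
      using breg_lower[OF \<theta>C[of n]] by (simp add: V_def)
  qed
  \<comment> \<open>The ratio \<open>2 * L / k\<close> compares \<open>V n\<close> with its
    decrease; adding 1 makes the factor \<open>1 - 1 / K\<close> positive.\<close>
  define K where "K = 2 * L / k + 1"
  have K: "K > 1"
    using L(1) k by (simp add: K_def)
  have contract: "V (Suc n) \<le> (1 - 1 / K) * V n" for n
  proof -
    define z where "z = \<zeta> (Suc n)"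
    define P where "P = (norm (z - \<theta>s))\<^sup>2"
    define Q where "Q = (norm (z - \<theta> n))\<^sup>2"
    have PQ: "P \<ge> 0" "Q \<ge> 0"
      by (auto simp: P_def Q_def)
    have descent: "V (Suc n) \<le> V n - \<eta> * (grad f z \<bullet> (z - \<theta>s)) - c * Q"
      unfolding V_def z_def c_def Q_def
      by (rule mirror_prox_step_descent
          [OF C(1) \<Phi>_diff ts \<theta>C sc assms(19) eta less_imp_le[OF eb] bet prox(2) prox(3)])
    have "k * P \<le> \<eta> * m * P"
      using PQ by (intro mult_right_mono) (auto simp: k_def)
    also have "\<dots> \<le> \<eta> * (grad f z \<bullet> (z - \<theta>s))"
      using m(2)[OF \<zeta>C[of n]] eta by (simp add: P_def z_def)
    finally have 1: "k * P \<le> \<eta> * (grad f z \<bullet> (z - \<theta>s))" .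
    have 2: "k * Q \<le> c * Q"
      using PQ by (intro mult_right_mono) (auto simp: k_def)
    \<comment> \<open>The decrease is measured at \<open>z\<close>, so the distance from
      \<open>\<theta> n\<close> to \<theta>s is split through \<open>z\<close> into \<open>P\<close>
      and \<open>Q\<close>.\<close>
    have "V n \<le> L * (norm (\<theta> n - \<theta>s))\<^sup>2"
      unfolding V_def by (rule breg_upper[OF \<theta>C])
    also have "\<dots> \<le> L * (2 * (P + Q))"
      unfolding P_def Q_def using L(1) by (intro mult_left_mono norm_diff_squared_le) auto
    also have "\<dots> = (2 * L / k) * (k * P + k * Q)"
      using k by (simp add: field_simps)
    also have "\<dots> \<le> K * (k * P + k * Q)"
      using PQ k by (intro mult_right_mono) (auto simp: K_def)
    also have "\<dots> \<le> K * (V n - V (Suc n))"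
      using descent 1 2 K by (intro mult_left_mono) auto
    finally have "V n / K \<le> V n - V (Suc n)"
      using K by (simp add: field_simps)
    then show ?thesis
      by (simp add: algebra_simps)
  qed
  define q where "q = 1 - 1 / K"
  have q: "0 \<le> q" "q < 1"
    using K by (auto simp: q_def)
  have V_geo: "V n \<le> V 0 * q ^ n" for n
  proof (induction n)
    case (Suc n)
    have "V (Suc n) \<le> q * V n"
      using contract[of n] by (simp add: q_def)
    also have "\<dots> \<le> q * (V 0 * q ^ n)"
      using Suc q by (intro mult_left_mono) auto
    finally show ?case by (simp add: algebra_simps)
  qed simp
  have "(norm (\<theta> n - \<theta>s))\<^sup>2 \<le> (2 / \<gamma> * V 0) * q ^ n" for n
    using order_trans[OF breg_lower[OF \<theta>C[of n]] V_geo[of n, unfolded V_def]] gam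
    by (simp add: V_def field_simps)
  from geometric_bound_imp_smallo[OF q this]
  obtain \<rho> where \<rho>: "0 < \<rho>" "\<rho> < 1" "(\<lambda>n. norm (\<theta> n - \<theta>s)) \<in> o(\<lambda>n. \<rho> ^ n)"
    by blast
  \<comment> \<open>Plain convergence is read off from the rate, since \<open>\<rho> ^ n\<close>
    itself tends to 0.\<close>
  have "(\<lambda>n. norm (\<theta> n - \<theta>s) / \<rho> ^ n * \<rho> ^ n) \<longlonglongrightarrow> 0 * 0"
    using \<rho> by (intro tendsto_mult[OF smalloD_tendsto[OF \<rho>(3)] LIMSEQ_realpow_zero]) auto
  then have "(\<lambda>n. norm (\<theta> n - \<theta>s)) \<longlonglongrightarrow> 0"
    using \<rho>(1) by simp
  then have "\<theta> \<longlonglongrightarrow> \<theta>s"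
    by (simp add: tendsto_norm_zero_iff LIM_zero_iff)
  with \<rho> show ?thesis by blast
qed

end
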